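(* A displacement field $\mathbf{u}:\Omega\to\mathbb{R}^3$ is universal for the monoclinic class $\mathbb{D}_2^v$ of linear strain-gradient elastic solids if and only if it is the superposition (sum) of a homogeneous displacement field and a field $(\alpha_1x_2x_3,\,\alpha_2x_1x_3,\,\alpha_3x_1x_2)$ for some constants $\alpha_1,\alpha_2,\alpha_3\in\mathbb{R}$.
   Context: $\Omega\subset\mathbb{R}^3$ is a nonempty convex open set with Cartesian coordinates $(x_1,x_2,x_3)$ and orthonormal basis $e_1,e_2,e_3$. Repeated indices are summed over $1,2,3$ and a comma denotes partial differentiation. A displacement field is a smooth map $\mathbf{u}:\Omega\to\mathbb{R}^3$, with strain $e_{lm}=\tfrac12(u_{l,m}+u_{m,l})$. It is homogeneous if $\mathbf{u}(\mathbf{x})=\mathbf{H}\mathbf{x}+\mathbf{b}$ for a constant matrix $\mathbf{H}$ and constant vector $\mathbf{b}$. A strain-gradient material is a triple $(\mathsf{C},\mathsf{M},\mathsf{A})$ of constant real tensors of orders $4,5,6$ with index symmetries $\mathsf{C}_{ijlm}=\mathsf{C}_{jilm}=\mathsf{C}_{lmij}$, $\mathsf{M}_{ijklm}=\mathsf{M}_{jiklm}=\mathsf{M}_{ijlkm}$, $\mathsf{A}_{ijklmn}=\mathsf{A}_{jiklmn}=\mathsf{A}_{lmnijk}$. Its stress and hyper-stress are $\sigma_{ij}=\mathsf{C}_{ijlm}e_{lm}+\mathsf{M}_{ijlmn}e_{lm,n}$ and $\tau_{ijk}=\mathsf{M}_{lmijk}e_{lm}+\mathsf{A}_{ijklmn}e_{lm,n}$,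 and the equilibrium equations without body forces are $\sigma_{ij,j}-\tau_{ijk,jk}=0$ in $\Omega$ for $i=1,2,3$. For a subgroup $G\subset \mathrm{O}(3)$, a tensor $T$ of order $p$ is $G$-invariant if $Q_{i_1j_1}\cdots Q_{i_pj_p}T_{j_1\dots j_p}=T_{i_1\dots i_p}$ for all $Q\in G$. $\mathbb{D}_2$ is the group generated by the rotations by $\pi$ about $e_3$ and about $e_1$; $\mathbb{D}_2^v$ is the group generated by the rotation by $\pi$ about $e_3$ and the reflection $x_1\mapsto -x_1$; $\mathbb{Z}_2^c=\{I,-I\}$, and $\mathbb{D}_2\oplus\mathbb{Z}_2^c$ is the group generated by $\mathbb{D}_2$ and $-I$. The monoclinic class $\mathbb{D}_2^v$ is the set of all materials with $\mathsf{C}$ and $\mathsf{A}$ $\mathbb{D}_2\oplus\mathbb{Z}_2^c$-invariant (9 and 51 independent constants) and $\mathsf{M}$ $\mathbb{D}_2^v$-invariant (28 independent constants). A displacement field is universal for the class if it satisfies the equilibrium equations for every material in the class. *)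

theory Defs
  imports "HOL-Analysis.Analysis" "HOL-Algebra.Generated_Groups"
begin

section \<open>Partial derivatives, smoothness, displacement fields\<close>

definition partial_deriv :: "3 \<Rightarrow> (real^3 \<Rightarrow> 'b::real_normed_vector) \<Rightarrow> real^3 \<Rightarrow> 'b" where
  "partial_deriv j f x = frechet_derivative f (at x) (axis j 1)"

text \<open>On an open set, differentiability of all iterated partial derivatives makes them all
  continuous, so this is the class of infinitely differentiable maps.\<close>

definition smooth_on :: "(real^3) set \<Rightarrow> (real^3 \<Rightarrow> 'b::real_normed_vector) \<Rightarrow> bool" where
  "smooth_on \<Omega> f \<longleftrightarrow> (\<forall>js. foldr partial_deriv js f differentiable_on \<Omega>)"

definition homogeneous_on :: "(real^3) set \<Rightarrow> (real^3 \<Rightarrow> real^3) \<Rightarrow> bool" where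
  "homogeneous_on \<Omega> u \<longleftrightarrow>
     (\<exists>(H :: real^3^3) (b :: real^3). \<forall>x\<in>\<Omega>. u x = H *v x + b)"


section \<open>Tensors and strain-gradient materials\<close>

type_synonym tensor4 = "3 \<Rightarrow> 3 \<Rightarrow> 3 \<Rightarrow> 3 \<Rightarrow> real"
type_synonym tensor5 = "3 \<Rightarrow> 3 \<Rightarrow> 3 \<Rightarrow> 3 \<Rightarrow> 3 \<Rightarrow> real"
type_synonym tensor6 = "3 \<Rightarrow> 3 \<Rightarrow> 3 \<Rightarrow> 3 \<Rightarrow> 3 \<Rightarrow> 3 \<Rightarrow> real"
type_synonym material = "tensor4 \<times> tensor5 \<times> tensor6"

definition index_symmetric :: "material \<Rightarrow> bool" where
  "index_symmetric = (\<lambda>(C, M, A).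
     (\<forall>i j l m. C i j l m = C j i l m \<and> C i j l m = C l m i j) \<and>
     (\<forall>i j k l m. M i j k l m = M j i k l m \<and> M i j k l m = M i j l k m) \<and>
     (\<forall>i j k l m n. A i j k l m n = A j i k l m n \<and> A i j k l m n = A l m n i j k))"

definition strain :: "(real^3 \<Rightarrow> real^3) \<Rightarrow> 3 \<Rightarrow> 3 \<Rightarrow> real^3 \<Rightarrow> real" where
  "strain u l m x =
     (partial_deriv m (\<lambda>y. u y $ l) x + partial_deriv l (\<lambda>y. u y $ m) x) / 2"

definition stress :: "material \<Rightarrow> (real^3 \<Rightarrow> real^3) \<Rightarrow> 3 \<Rightarrow> 3 \<Rightarrow> real^3 \<Rightarrow> real" where
  "stress = (\<lambda>(C, M, A) u i j x.
     (\<Sum>l\<in>UNIV. \<Sum>m\<in>UNIV. C i j l m * strain u l m x) +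
     (\<Sum>l\<in>UNIV. \<Sum>m\<in>UNIV. \<Sum>n\<in>UNIV. M i j l m n * partial_deriv n (strain u l m) x))"

definition hyperstress ::
  "material \<Rightarrow> (real^3 \<Rightarrow> real^3) \<Rightarrow> 3 \<Rightarrow> 3 \<Rightarrow> 3 \<Rightarrow> real^3 \<Rightarrow> real" where
  "hyperstress = (\<lambda>(C, M, A) u i j k x.
     (\<Sum>l\<in>UNIV. \<Sum>m\<in>UNIV. M l m i j k * strain u l m x) +
     (\<Sum>l\<in>UNIV. \<Sum>m\<in>UNIV. \<Sum>n\<in>UNIV. A i j k l m n * partial_deriv n (strain u l m) x))"

definition equilibrium :: "(real^3) set \<Rightarrow> material \<Rightarrow> (real^3 \<Rightarrow> real^3) \<Rightarrow> bool" where
  "equilibrium \<Omega> \<mu> u \<longleftrightarrow>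
     (\<forall>x\<in>\<Omega>. \<forall>i.
        (\<Sum>j\<in>UNIV. partial_deriv j (stress \<mu> u i j) x) -
        (\<Sum>j\<in>UNIV. \<Sum>k\<in>UNIV. partial_deriv k (partial_deriv j (hyperstress \<mu> u i j k)) x) = 0)"

definition universal :: "material set \<Rightarrow> (real^3) set \<Rightarrow> (real^3 \<Rightarrow> real^3) \<Rightarrow> bool" where
  "universal \<K> \<Omega> u \<longleftrightarrow> (\<forall>\<mu>\<in>\<K>. equilibrium \<Omega> \<mu> u)"


section \<open>Symmetry groups\<close>

definition O3 :: "(real^3^3) monoid" where
  "O3 = \<lparr>carrier = {Q. orthogonal_matrix Q}, mult = (**), one = mat 1\<rparr>"

text \<open>Ensures that the inverse used in \<^const>\<open>generate\<close> is the matrix inverse.\<close>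

lemma group_O3: "group O3"
proof (rule groupI)
  fix Q assume "Q \<in> carrier O3"
  then show "\<exists>R\<in>carrier O3. R \<otimes>\<^bsub>O3\<^esub> Q = \<one>\<^bsub>O3\<^esub>"
    by (intro bexI[of _ "transpose Q"]) (auto simp: O3_def orthogonal_matrix_def)
qed (auto simp: O3_def orthogonal_matrix_mul orthogonal_matrix_id matrix_mul_assoc)

definition rotation_e1 :: "real \<Rightarrow> real^3^3" where
  "rotation_e1 \<theta> = vector [vector [1, 0, 0],
                           vector [0, cos \<theta>, - sin \<theta>],
                           vector [0, sin \<theta>, cos \<theta>]]"

definition rotation_e3 :: "real \<Rightarrow> real^3^3" where
  "rotation_e3 \<theta> = vector [vector [cos \<theta>, - sin \<theta>, 0],
                           vector [sin \<theta>, cos \<theta>, 0],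
                           vector [0, 0, 1]]"

definition reflection_e1 :: "real^3^3" where
  "reflection_e1 = vector [vector [- 1, 0, 0], vector [0, 1, 0], vector [0, 0, 1]]"

definition D2 :: "(real^3^3) set" where
  "D2 = generate O3 {rotation_e3 pi, rotation_e1 pi}"

definition D2v :: "(real^3^3) set" where
  "D2v = generate O3 {rotation_e3 pi, reflection_e1}"

definition D2_Z2c :: "(real^3^3) set" where
  "D2_Z2c = generate O3 (D2 \<union> {- mat 1})"

lemma generators_in_O3: "{rotation_e3 pi, rotation_e1 pi, reflection_e1, - mat 1} \<subseteq> carrier O3"
  by (auto simp: O3_def orthogonal_matrix rotation_e1_def rotation_e3_def reflection_e1_def
      vec_eq_iff forall_3 matrix_matrix_mult_def transpose_def mat_def sum_3)

definition invariant4 :: "(real^3^3) set \<Rightarrow> tensor4 \<Rightarrow> bool" where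
  "invariant4 G T \<longleftrightarrow> (\<forall>Q\<in>G. \<forall>i1 i2 i3 i4.
     (\<Sum>j1\<in>UNIV. \<Sum>j2\<in>UNIV. \<Sum>j3\<in>UNIV. \<Sum>j4\<in>UNIV.
        Q$i1$j1 * Q$i2$j2 * Q$i3$j3 * Q$i4$j4 * T j1 j2 j3 j4) = T i1 i2 i3 i4)"

definition invariant5 :: "(real^3^3) set \<Rightarrow> tensor5 \<Rightarrow> bool" where
  "invariant5 G T \<longleftrightarrow> (\<forall>Q\<in>G. \<forall>i1 i2 i3 i4 i5.
     (\<Sum>j1\<in>UNIV. \<Sum>j2\<in>UNIV. \<Sum>j3\<in>UNIV. \<Sum>j4\<in>UNIV. \<Sum>j5\<in>UNIV.
        Q$i1$j1 * Q$i2$j2 * Q$i3$j3 * Q$i4$j4 * Q$i5$j5 * T j1 j2 j3 j4 j5) = T i1 i2 i3 i4 i5)"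

definition invariant6 :: "(real^3^3) set \<Rightarrow> tensor6 \<Rightarrow> bool" where
  "invariant6 G T \<longleftrightarrow> (\<forall>Q\<in>G. \<forall>i1 i2 i3 i4 i5 i6.
     (\<Sum>j1\<in>UNIV. \<Sum>j2\<in>UNIV. \<Sum>j3\<in>UNIV. \<Sum>j4\<in>UNIV. \<Sum>j5\<in>UNIV. \<Sum>j6\<in>UNIV.
        Q$i1$j1 * Q$i2$j2 * Q$i3$j3 * Q$i4$j4 * Q$i5$j5 * Q$i6$j6 * T j1 j2 j3 j4 j5 j6)
     = T i1 i2 i3 i4 i5 i6)"

definition class_D2v :: "material set" where
  "class_D2v = {(C, M, A). index_symmetric (C, M, A) \<and>
     invariant4 D2_Z2c C \<and> invariant5 D2v M \<and> invariant6 D2_Z2c A}"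

end

theory Submission
  imports Defs
begin

text \<open>The classical part \<open>C\<close> of the class alone forces the displacement into the stated form, so
  necessity only tests materials with \<open>M = 0\<close> and \<open>A = 0\<close>. The constants \<open>C\<^sub>a\<^sub>a\<^sub>b\<^sub>b\<close> give
  \<open>u\<^sub>b\<^sub>,\<^sub>a\<^sub>b = 0\<close>, and then the shear constants \<open>C\<^sub>a\<^sub>b\<^sub>a\<^sub>b\<close> give \<open>u\<^sub>a\<^sub>,\<^sub>b\<^sub>b = 0\<close>. The only
  surviving second derivatives are \<open>u\<^sub>a\<^sub>,\<^sub>j\<^sub>k\<close> with \<open>a\<close>, \<open>j\<close>, \<open>k\<close> distinct, and these are constant.
  Conversely, such a field has a constant strain gradient, whose components \<open>e\<^sub>l\<^sub>m\<^sub>,\<^sub>n\<close> vanish unless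
  \<open>l\<close>, \<open>m\<close>, \<open>n\<close> are distinct, and invariance of \<open>C\<close> under the diagonal sign matrices makes
  \<open>C\<^sub>i\<^sub>n\<^sub>l\<^sub>m = 0\<close> for such indices.\<close>

section \<open>Calculus of partial derivatives\<close>

lemma partial_deriv_eqI: "(f has_derivative f') (at x) \<Longrightarrow> partial_deriv j f x = f' (axis j 1)"
  unfolding partial_deriv_def by (metis frechet_derivative_at)

text \<open>\<open>frechet_derivative\<close> is a choice over \<open>has_derivative\<close>, and
  that predicate sees only the values of the function near \<open>x\<close>. Hence the equality also
  covers points where neither function is differentiable.\<close>

lemma partial_deriv_cong:
  assumes "open \<Omega>" "x \<in> \<Omega>" "\<And>y. y \<in> \<Omega> \<Longrightarrow> f y = g y"
  shows "partial_deriv j f x = partial_deriv j g x"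
proof -
  have "(f has_derivative d) (at x) \<longleftrightarrow> (g has_derivative d) (at x)" for d
    using has_derivative_transform_within_open[of f d x UNIV \<Omega> g]
      has_derivative_transform_within_open[of g d x UNIV \<Omega> f] assms by auto
  then show ?thesis by (simp add: partial_deriv_def frechet_derivative_def)
qed

lemma partial_deriv_const: "partial_deriv j (\<lambda>x. c) x = 0"
  by (simp add: partial_deriv_def)

lemma partial_deriv_eq_0:
  assumes "open \<Omega>" "x \<in> \<Omega>" "\<And>y. y \<in> \<Omega> \<Longrightarrow> f y = c"
  shows "partial_deriv j f x = 0"
  using partial_deriv_cong[OF assms] by (simp add: partial_deriv_const)

lemma partial_deriv_add:
  assumes "f differentiable at x" "g differentiable at x"
  shows "partial_deriv j (\<lambda>x. f x + g x) x = partial_deriv j f x + partial_deriv j g x"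
  unfolding partial_deriv_def[of j f] partial_deriv_def[of j g]
  using assms by (intro partial_deriv_eqI has_derivative_add) (simp_all add: frechet_derivative_works)

lemma partial_deriv_diff:
  assumes "f differentiable at x" "g differentiable at x"
  shows "partial_deriv j (\<lambda>x. f x - g x) x = partial_deriv j f x - partial_deriv j g x"
  unfolding partial_deriv_def[of j f] partial_deriv_def[of j g]
  using assms by (intro partial_deriv_eqI has_derivative_diff) (simp_all add: frechet_derivative_works)

lemma partial_deriv_bounded_linear:
  assumes "bounded_linear L" "f differentiable at x"
  shows "partial_deriv j (\<lambda>x. L (f x)) x = L (partial_deriv j f x)"
proof -
  have "(f has_derivative frechet_derivative f (at x)) (at x)"
    using assms(2) by (simp add: frechet_derivative_works)
  from partial_deriv_eqI[OF bounded_linear.has_derivative[OF assms(1) this]]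
  show ?thesis by (simp add: partial_deriv_def)
qed

lemma has_derivative_partial_derivs:
  fixes f :: "real^3 \<Rightarrow> real"
  assumes "f differentiable at x"
  shows "(f has_derivative (\<lambda>h. \<Sum>j\<in>UNIV. h $ j * partial_deriv j f x)) (at x)"
proof -
  have d: "(f has_derivative frechet_derivative f (at x)) (at x)"
    using assms by (simp add: frechet_derivative_works)
  then interpret D: linear "frechet_derivative f (at x)"
    by (rule has_derivative_linear)
  have "frechet_derivative f (at x) h = (\<Sum>j\<in>UNIV. h $ j * partial_deriv j f x)" for h
  proof -
    have "h = (\<Sum>j\<in>UNIV. h $ j *\<^sub>R axis j 1)"
      using basis_expansion[of h] by (simp add: scalar_mult_eq_scaleR)
    then have "frechet_derivative f (at x) h
        = frechet_derivative f (at x) (\<Sum>j\<in>UNIV. h $ j *\<^sub>R axis j 1)" by simp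
    also have "\<dots> = (\<Sum>j\<in>UNIV. h $ j * partial_deriv j f x)"
      by (simp only: D.sum D.scaleR partial_deriv_def real_scaleR_def)
    finally show ?thesis .
  qed
  then have "frechet_derivative f (at x) = (\<lambda>h. \<Sum>j\<in>UNIV. h $ j * partial_deriv j f x)"
    by blast
  with d show ?thesis by simp
qed

text \<open>By linearity the partial derivatives determine the total derivative, so
  \<open>f - g\<close> has derivative zero on a convex set. This is the integration step of the
  whole proof.\<close>

lemma partial_derivs_eq_imp_diff_const:
  fixes f g :: "real^3 \<Rightarrow> real"
  assumes "open \<Omega>" "convex \<Omega>"
    and "\<And>x. x \<in> \<Omega> \<Longrightarrow> f differentiable at x" "\<And>x. x \<in> \<Omega> \<Longrightarrow> g differentiable at x"
    and "\<And>x j. x \<in> \<Omega> \<Longrightarrow> partial_deriv j f x = partial_deriv j g x"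
  shows "\<exists>c. \<forall>x\<in>\<Omega>. f x - g x = c"
proof (rule has_derivative_zero_constant[OF \<open>convex \<Omega>\<close>])
  fix x assume x: "x \<in> \<Omega>"
  have "(\<lambda>x. f x - g x) differentiable at x"
    using x assms by (intro differentiable_diff)
  from has_derivative_partial_derivs[OF this]
  have "((\<lambda>x. f x - g x) has_derivative (\<lambda>h. 0)) (at x)"
    using x assms by (simp add: partial_deriv_diff)
  then show "((\<lambda>x. f x - g x) has_derivative (\<lambda>h. 0)) (at x within \<Omega>)"
    by (rule has_derivative_at_withinI)
qed

section \<open>Symmetry of second partial derivatives\<close>

lemma has_real_derivative_along_axis:
  fixes f :: "real^3 \<Rightarrow> real"
  assumes "f differentiable at (x + s *\<^sub>R axis i 1)"
  shows "((\<lambda>s. f (x + s *\<^sub>R axis i 1)) has_real_derivative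
          partial_deriv i f (x + s *\<^sub>R axis i 1)) (at s)"
proof -
  let ?D = "frechet_derivative f (at (x + s *\<^sub>R axis i 1))"
  have D: "(f has_derivative ?D) (at (x + s *\<^sub>R axis i 1))"
    using assms by (simp add: frechet_derivative_works)
  have "((\<lambda>s. x + s *\<^sub>R axis i 1) has_derivative (\<lambda>h. h *\<^sub>R axis i 1)) (at s)"
    by (auto intro!: derivative_eq_intros)
  from has_derivative_compose[OF this D]
  show ?thesis
    using linear_cmul[OF has_derivative_linear[OF D]]
    by (simp add: has_field_derivative_def partial_deriv_def mult.commute[of _ "?D _"])
qed

text \<open>The mean value theorem is applied twice: to the increment in direction \<open>j\<close>
  as a function of the \<open>i\<close> coordinate, then to \<open>partial_deriv i f\<close> along
  direction \<open>j\<close>.\<close>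

lemma second_difference_mean_value:
  fixes f :: "real^3 \<Rightarrow> real"
  assumes f: "\<And>y. y \<in> ball x r \<Longrightarrow> f differentiable at y"
    and f': "\<And>y. y \<in> ball x r \<Longrightarrow> partial_deriv i f differentiable at y"
    and h: "0 < h" "2 * h < r"
  shows "\<exists>p. dist p x \<le> 2 * h \<and>
    f (x + h *\<^sub>R axis i 1 + h *\<^sub>R axis j 1) - f (x + h *\<^sub>R axis i 1) - f (x + h *\<^sub>R axis j 1) + f x
      = h * h * partial_deriv j (partial_deriv i f) p"
proof -
  let ?e = "\<lambda>i. axis i 1 :: real^3"
  have close: "norm (s *\<^sub>R ?e i + t *\<^sub>R ?e j) \<le> 2 * h"
    if "0 \<le> s" "s \<le> h" "0 \<le> t" "t \<le> h" for s t
    using that norm_triangle_ineq[of "s *\<^sub>R ?e i" "t *\<^sub>R ?e j"] by simp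
  have in_ball: "x + s *\<^sub>R ?e i + t *\<^sub>R ?e j \<in> ball x r"
    if "0 \<le> s" "s \<le> h" "0 \<le> t" "t \<le> h" for s t
  proof -
    have "dist (x + s *\<^sub>R ?e i + t *\<^sub>R ?e j) x = norm (s *\<^sub>R ?e i + t *\<^sub>R ?e j)"
      by (simp add: dist_norm add.assoc)
    then show ?thesis using close[OF that] h by (simp add: dist_commute)
  qed
  \<comment> \<open>The second difference of the claim is
    \<open>?\<phi> h - ?\<phi> 0\<close>.\<close>
  let ?\<phi> = "\<lambda>s. f ((x + h *\<^sub>R ?e j) + s *\<^sub>R ?e i) - f (x + s *\<^sub>R ?e i)"
  have "\<exists>s>0. s < h \<and> ?\<phi> h - ?\<phi> 0 = (h - 0) *
     (partial_deriv i f ((x + h *\<^sub>R ?e j) + s *\<^sub>R ?e i) - partial_deriv i f (x + s *\<^sub>R ?e i))"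
  proof (rule MVT2[OF h(1)])
    fix s assume s: "0 \<le> s" "s \<le> h"
    have "(x + h *\<^sub>R ?e j) + s *\<^sub>R ?e i \<in> ball x r"
      using in_ball[OF s, of h] h by (simp add: algebra_simps)
    moreover have "x + s *\<^sub>R ?e i \<in> ball x r"
      using in_ball[OF s, of 0] h by simp
    ultimately show "(?\<phi> has_real_derivative
        (partial_deriv i f ((x + h *\<^sub>R ?e j) + s *\<^sub>R ?e i) - partial_deriv i f (x + s *\<^sub>R ?e i))) (at s)"
      using f by (intro DERIV_diff has_real_derivative_along_axis)
  qed
  then obtain s where s: "0 < s" "s < h" and
    \<phi>: "?\<phi> h - ?\<phi> 0 = h *
     (partial_deriv i f ((x + h *\<^sub>R ?e j) + s *\<^sub>R ?e i) - partial_deriv i f (x + s *\<^sub>R ?e i))"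
    by auto
  let ?\<psi> = "\<lambda>t. partial_deriv i f ((x + s *\<^sub>R ?e i) + t *\<^sub>R ?e j)"
  have "\<exists>t>0. t < h \<and> ?\<psi> h - ?\<psi> 0 = (h - 0) *
     partial_deriv j (partial_deriv i f) ((x + s *\<^sub>R ?e i) + t *\<^sub>R ?e j)"
    using s f' in_ball by (intro MVT2[OF h(1)] has_real_derivative_along_axis) auto
  then obtain t where t: "0 < t" "t < h" and
    \<psi>: "?\<psi> h - ?\<psi> 0 = h * partial_deriv j (partial_deriv i f) ((x + s *\<^sub>R ?e i) + t *\<^sub>R ?e j)"
    by auto
  have "dist (x + s *\<^sub>R ?e i + t *\<^sub>R ?e j) x \<le> 2 * h"
    using close[of s t] s t by (simp add: dist_norm add.assoc)
  moreover have "?\<phi> h - ?\<phi> 0 = h * (?\<psi> h - ?\<psi> 0)"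
    unfolding \<phi> by (simp add: algebra_simps)
  ultimately show ?thesis
    unfolding \<psi> by (intro exI[of _ "x + s *\<^sub>R ?e i + t *\<^sub>R ?e j"]) (simp add: algebra_simps)
qed

text \<open>The second difference is symmetric in \<open>i\<close> and \<open>j\<close>, so both
  mixed derivatives agree at intermediate points \<open>p n\<close> and \<open>q n\<close>. These
  points tend to \<open>x\<close>, and continuity carries the equality to the limit.\<close>

lemma partial_deriv_commute_at:
  fixes f :: "real^3 \<Rightarrow> real"
  assumes r: "r > 0"
    and f: "\<And>y. y \<in> ball x r \<Longrightarrow> f differentiable at y"
    and f': "\<And>i y. y \<in> ball x r \<Longrightarrow> partial_deriv i f differentiable at y"
    and cont: "\<And>i j. isCont (partial_deriv j (partial_deriv i f)) x"
  shows "partial_deriv j (partial_deriv i f) x = partial_deriv i (partial_deriv j f) x"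
proof -
  \<comment> \<open>The summand 3 gives \<open>2 * h n < r\<close> already at \<open>n = 0\<close>,
    which keeps the squares inside the ball.\<close>
  define h where "h n = r / (3 + real n)" for n
  have "0 < h n \<and> 2 * h n < r" for n
    using r by (auto simp: h_def field_simps intro: add_pos_nonneg)
  then have h: "0 < h n" "2 * h n < r" for n by auto
  obtain p where p: "\<And>n. dist (p n) x \<le> 2 * h n" and
    p_eq: "\<And>n. f (x + h n *\<^sub>R axis i 1 + h n *\<^sub>R axis j 1) - f (x + h n *\<^sub>R axis i 1)
      - f (x + h n *\<^sub>R axis j 1) + f x = h n * h n * partial_deriv j (partial_deriv i f) (p n)"
    using second_difference_mean_value[OF f f' h, where i = i and j = j] by metis
  obtain q where q: "\<And>n. dist (q n) x \<le> 2 * h n" and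
    q_eq: "\<And>n. f (x + h n *\<^sub>R axis j 1 + h n *\<^sub>R axis i 1) - f (x + h n *\<^sub>R axis j 1)
      - f (x + h n *\<^sub>R axis i 1) + f x = h n * h n * partial_deriv i (partial_deriv j f) (q n)"
    using second_difference_mean_value[OF f f' h, where i = j and j = i] by metis
  have eq: "partial_deriv j (partial_deriv i f) (p n) = partial_deriv i (partial_deriv j f) (q n)" for n
  proof -
    have "h n * h n * partial_deriv j (partial_deriv i f) (p n)
        = h n * h n * partial_deriv i (partial_deriv j f) (q n)"
      unfolding p_eq[symmetric] q_eq[symmetric] by (simp add: algebra_simps)
    then show ?thesis using h(1)[of n] by simp
  qed
  have "h \<longlonglongrightarrow> 0"
    unfolding h_def
    by (rule real_tendsto_divide_at_top[OF tendsto_const],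
        rule filterlim_tendsto_add_at_top[OF tendsto_const filterlim_real_sequentially])
  then have lim: "(\<lambda>n. 2 * h n) \<longlonglongrightarrow> 0"
    by (rule tendsto_mult_right_zero)
  have "p \<longlonglongrightarrow> x"
    using p by (intro metric_tendsto_imp_tendsto[OF lim]) (auto simp: h less_imp_le)
  from isCont_tendsto_compose[OF cont this]
  have "(\<lambda>n. partial_deriv j (partial_deriv i f) (p n)) \<longlonglongrightarrow> partial_deriv j (partial_deriv i f) x" .
  moreover have "q \<longlonglongrightarrow> x"
    using q by (intro metric_tendsto_imp_tendsto[OF lim]) (auto simp: h less_imp_le)
  from isCont_tendsto_compose[OF cont this]
  have "(\<lambda>n. partial_deriv i (partial_deriv j f) (q n)) \<longlonglongrightarrow> partial_deriv i (partial_deriv j f) x" .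
  ultimately show ?thesis
    unfolding eq by (rule LIMSEQ_unique)
qed

section \<open>Smooth functions\<close>

lemma smooth_on_differentiable:
  assumes "smooth_on \<Omega> f" "open \<Omega>" "x \<in> \<Omega>"
  shows "f differentiable at x"
proof -
  have "foldr partial_deriv [] f differentiable_on \<Omega>"
    using assms(1) unfolding smooth_on_def by blast
  then show ?thesis using assms(2,3) by (simp add: differentiable_on_eq_differentiable_at)
qed

lemma smooth_on_partial_deriv:
  assumes "smooth_on \<Omega> f"
  shows "smooth_on \<Omega> (partial_deriv j f)"
  unfolding smooth_on_def
proof
  fix js
  \<comment> \<open>The last entry of the list is the first to act under \<open>foldr\<close>, so
    appending \<open>j\<close> differentiates \<open>f\<close> before \<open>js\<close>
    does.\<close>
  have "foldr partial_deriv (js @ [j]) f differentiable_on \<Omega>"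
    using assms unfolding smooth_on_def by blast
  then show "foldr partial_deriv js (partial_deriv j f) differentiable_on \<Omega>" by simp
qed

lemma smooth_on_foldr: "smooth_on \<Omega> f \<Longrightarrow> smooth_on \<Omega> (foldr partial_deriv js f)"
  by (induction js) (auto intro: smooth_on_partial_deriv)

text \<open>Smoothness speaks of all index lists, so it is enough to have a formula
  \<open>g js\<close> for every iterated derivative on \<Omega>. Differentiability passes from the
  formula to the derivative because they agree on an open set.\<close>

lemma smooth_onI:
  assumes "open \<Omega>"
    and "\<And>js x. x \<in> \<Omega> \<Longrightarrow> foldr partial_deriv js f x = g js x"
    and "\<And>js x. x \<in> \<Omega> \<Longrightarrow> g js differentiable at x"
  shows "smooth_on \<Omega> f"
  unfolding smooth_on_def
proof
  fix js
  have "foldr partial_deriv js f differentiable at x" if x: "x \<in> \<Omega>" for x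
  proof -
    obtain d where "(g js has_derivative d) (at x)"
      using assms(3)[OF x] unfolding differentiable_def by blast
    from has_derivative_transform_within_open[OF this assms(1) x assms(2)[symmetric]]
    show ?thesis unfolding differentiable_def by blast
  qed
  then show "foldr partial_deriv js f differentiable_on \<Omega>"
    using assms(1) by (simp add: differentiable_on_eq_differentiable_at)
qed

lemma smooth_on_bounded_linear:
  assumes "open \<Omega>" "smooth_on \<Omega> f" "bounded_linear L"
  shows "smooth_on \<Omega> (\<lambda>x. L (f x))"
proof (rule smooth_onI[OF \<open>open \<Omega>\<close>])
  note d = smooth_on_differentiable[OF smooth_on_foldr[OF assms(2)] assms(1)]
  show "foldr partial_deriv js (\<lambda>x. L (f x)) x = L (foldr partial_deriv js f x)" if "x \<in> \<Omega>" for js x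
    using that
  proof (induction js arbitrary: x)
    case (Cons j js)
    have "partial_deriv j (foldr partial_deriv js (\<lambda>x. L (f x))) x
        = partial_deriv j (\<lambda>x. L (foldr partial_deriv js f x)) x"
      using Cons by (intro partial_deriv_cong[OF assms(1)]) auto
    then show ?case
      using Cons.prems by (simp add: partial_deriv_bounded_linear assms(3) d)
  qed simp
  show "(\<lambda>x. L (foldr partial_deriv js f x)) differentiable at x" if "x \<in> \<Omega>" for js x
    using d[OF that] assms(3)
    by (metis bounded_linear.has_derivative differentiable_def)
qed

lemma smooth_on_add:
  assumes "open \<Omega>" "smooth_on \<Omega> f" "smooth_on \<Omega> g"
  shows "smooth_on \<Omega> (\<lambda>x. f x + g x)"
proof (rule smooth_onI[OF \<open>open \<Omega>\<close>])
  note df = smooth_on_differentiable[OF smooth_on_foldr[OF assms(2)] assms(1)]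
  note dg = smooth_on_differentiable[OF smooth_on_foldr[OF assms(3)] assms(1)]
  show "foldr partial_deriv js (\<lambda>x. f x + g x) x
      = foldr partial_deriv js f x + foldr partial_deriv js g x" if "x \<in> \<Omega>" for js x
    using that
  proof (induction js arbitrary: x)
    case (Cons j js)
    have "partial_deriv j (foldr partial_deriv js (\<lambda>x. f x + g x)) x
        = partial_deriv j (\<lambda>x. foldr partial_deriv js f x + foldr partial_deriv js g x) x"
      using Cons by (intro partial_deriv_cong[OF assms(1)]) auto
    then show ?case
      using Cons.prems by (simp add: partial_deriv_add df dg)
  qed simp
  show "(\<lambda>x. foldr partial_deriv js f x + foldr partial_deriv js g x) differentiable at x"
    if "x \<in> \<Omega>" for js x
    using df dg that by (intro differentiable_add)
qed

lemma smooth_on_const: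
  assumes "open \<Omega>"
  shows "smooth_on \<Omega> (\<lambda>x. c)"
proof (rule smooth_onI[OF assms])
  show "foldr partial_deriv js (\<lambda>x. c) x = (if js = [] then c else 0)" for js and x :: "real^3"
  proof (induction js arbitrary: x)
    case (Cons j js)
    then have "foldr partial_deriv js (\<lambda>x. c) = (\<lambda>x. if js = [] then c else 0)" by blast
    then show ?case by (simp add: partial_deriv_const)
  qed simp
qed simp

lemma smooth_on_cmult:
  fixes f :: "real^3 \<Rightarrow> real"
  shows "open \<Omega> \<Longrightarrow> smooth_on \<Omega> f \<Longrightarrow> smooth_on \<Omega> (\<lambda>x. c * f x)"
  using smooth_on_bounded_linear[OF _ _ bounded_linear_mult_right] .

lemma smooth_on_sum:
  assumes "open \<Omega>" "\<And>i. i \<in> I \<Longrightarrow> smooth_on \<Omega> (f i)"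
  shows "smooth_on \<Omega> (\<lambda>x. \<Sum>i\<in>I. f i x)"
  using assms(2)
  by (induction I rule: infinite_finite_induct) (auto intro: smooth_on_add smooth_on_const assms(1))

lemma partial_deriv_cmult:
  fixes f :: "real^3 \<Rightarrow> real"
  assumes "open \<Omega>" "x \<in> \<Omega>" "smooth_on \<Omega> f"
  shows "partial_deriv j (\<lambda>x. c * f x) x = c * partial_deriv j f x"
  using assms
  by (intro partial_deriv_bounded_linear bounded_linear_mult_right smooth_on_differentiable)

lemma partial_deriv_sum:
  assumes "open \<Omega>" "x \<in> \<Omega>" "\<And>i. i \<in> I \<Longrightarrow> smooth_on \<Omega> (f i)"
  shows "partial_deriv j (\<lambda>x. \<Sum>i\<in>I. f i x) x = (\<Sum>i\<in>I. partial_deriv j (f i) x)"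
  using assms(3)
proof (induction I rule: infinite_finite_induct)
  case (insert i I)
  then have "smooth_on \<Omega> (f i)" "smooth_on \<Omega> (\<lambda>x. \<Sum>i\<in>I. f i x)"
    by (auto intro: smooth_on_sum assms(1))
  then have "f i differentiable at x" "(\<lambda>x. \<Sum>i\<in>I. f i x) differentiable at x"
    using smooth_on_differentiable assms(1,2) by blast+
  then show ?case using insert by (simp add: partial_deriv_add)
qed (simp_all add: partial_deriv_const)

lemma partial_deriv_commute:
  fixes f :: "real^3 \<Rightarrow> real"
  assumes "open \<Omega>" "smooth_on \<Omega> f" "x \<in> \<Omega>"
  shows "partial_deriv j (partial_deriv i f) x = partial_deriv i (partial_deriv j f) x"
proof -
  obtain r where r: "r > 0" "ball x r \<subseteq> \<Omega>"
    using assms open_contains_ball by blast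
  note d = smooth_on_differentiable[OF _ \<open>open \<Omega>\<close>]
  show ?thesis
  proof (rule partial_deriv_commute_at[OF r(1)])
    show "isCont (partial_deriv j (partial_deriv i f)) x" for i j
      using d[OF smooth_on_partial_deriv[OF smooth_on_partial_deriv[OF assms(2)]] assms(3)]
      by (rule differentiable_imp_continuous_within)
  qed (use d assms(2) smooth_on_partial_deriv r(2) in blast)+
qed

section \<open>Quadratic functions\<close>

text \<open>For symmetric \<open>D\<close>, the Taylor polynomial at the origin with gradient
  \<open>w\<close> and Hessian \<open>D\<close>. With \<open>D = 0\<close> it is affine, so the
  partial derivatives of a quadratic are again of this form.\<close>

definition quadratic :: "real \<Rightarrow> (3 \<Rightarrow> real) \<Rightarrow> (3 \<Rightarrow> 3 \<Rightarrow> real) \<Rightarrow> real^3 \<Rightarrow> real" where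
  "quadratic b w D x =
     b + (\<Sum>k\<in>UNIV. w k * x $ k) + (\<Sum>j\<in>UNIV. \<Sum>k\<in>UNIV. D j k * x $ j * x $ k) / 2"

lemma has_derivative_component: "((\<lambda>x. x $ k) has_derivative (\<lambda>h. h $ k)) (at x)"
  by (rule bounded_linear_imp_has_derivative[OF bounded_linear_vec_nth])

lemma quadratic_has_derivative:
  assumes "\<And>j k. D j k = D k j"
  shows "(quadratic b w D has_derivative
           (\<lambda>h. \<Sum>j\<in>UNIV. h $ j * quadratic (w j) (D j) (\<lambda>_ _. 0) x)) (at x)"
  unfolding quadratic_def
  by (rule derivative_eq_intros has_derivative_component refl | simp)+
     (simp add: fun_eq_iff sum_3 field_simps assms[of 2 1] assms[of 3 1] assms[of 3 2])

lemma quadratic_differentiable: "(\<And>j k. D j k = D k j) \<Longrightarrow> quadratic b w D differentiable at x"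
  using quadratic_has_derivative unfolding differentiable_def by blast

lemma partial_deriv_quadratic:
  assumes "\<And>j k. D j k = D k j"
  shows "partial_deriv j (quadratic b w D) x = quadratic (w j) (D j) (\<lambda>_ _. 0) x"
  using partial_deriv_eqI[OF quadratic_has_derivative[of D b w x, OF assms], of j]
  by (simp add: axis_def if_distrib[of "\<lambda>c. c * _"] cong: if_cong)

lemma partial_deriv_affine: "partial_deriv j (quadratic b w (\<lambda>_ _. 0)) x = w j"
  by (simp add: partial_deriv_quadratic) (simp add: quadratic_def)

text \<open>Two integrations: each first derivative is affine up to a constant \<open>w j\<close>,
  and then \<open>f\<close> is quadratic up to a constant.\<close>

lemma constant_second_derivs_imp_quadratic:
  fixes f :: "real^3 \<Rightarrow> real"
  assumes "open \<Omega>" "convex \<Omega>" "smooth_on \<Omega> f" and sym: "\<And>j k. D j k = D k j"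
    and D: "\<And>x j k. x \<in> \<Omega> \<Longrightarrow> partial_deriv k (partial_deriv j f) x = D j k"
  shows "\<exists>b w. \<forall>x\<in>\<Omega>. f x = quadratic b w D x"
proof -
  note d = smooth_on_differentiable[OF _ \<open>open \<Omega>\<close>]
  have "\<exists>c. \<forall>x\<in>\<Omega>. partial_deriv j f x - quadratic 0 (D j) (\<lambda>_ _. 0) x = c" for j
    using d[OF smooth_on_partial_deriv[OF assms(3)]]
    by (intro partial_derivs_eq_imp_diff_const assms quadratic_differentiable)
       (auto simp: partial_deriv_affine D)
  then obtain w where w: "\<And>j x. x \<in> \<Omega> \<Longrightarrow>
      partial_deriv j f x - quadratic 0 (D j) (\<lambda>_ _. 0) x = w j"
    by metis
  have "\<exists>c. \<forall>x\<in>\<Omega>. f x - quadratic 0 w D x = c"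
  proof (intro partial_derivs_eq_imp_diff_const assms quadratic_differentiable sym)
    fix x j assume x: "x \<in> \<Omega>"
    show "partial_deriv j f x = partial_deriv j (quadratic 0 w D) x"
      using w[OF x, of j] by (simp add: partial_deriv_quadratic sym quadratic_def)
  qed (rule d[OF assms(3)])
  then obtain c where "\<And>x. x \<in> \<Omega> \<Longrightarrow> f x - quadratic 0 w D x = c" by blast
  then have "\<forall>x\<in>\<Omega>. f x = quadratic c w D x" by (force simp: quadratic_def)
  then show ?thesis by blast
qed

section \<open>Tensors invariant under diagonal sign matrices\<close>

text \<open>Diagonal matrices with entries 1 or -1. Every element of \<open>D2_Z2c\<close> is of
  this kind, and its action on a tensor only multiplies each component by a sign.\<close>

definition sign_matrix :: "real^3^3 \<Rightarrow> bool" where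
  "sign_matrix Q \<longleftrightarrow> (\<forall>i j. i \<noteq> j \<longrightarrow> Q $ i $ j = 0) \<and> (\<forall>i. Q $ i $ i * Q $ i $ i = 1)"

lemma sign_matrix_mult_component:
  assumes "sign_matrix P"
  shows "(P ** R) $ i $ j = P $ i $ i * R $ i $ j"
proof -
  have P: "P $ i $ k * c = (if k = i then P $ i $ i * c else 0)" for k c
    using assms by (auto simp: sign_matrix_def)
  show ?thesis
    unfolding matrix_matrix_mult_def by (subst vec_lambda_beta, subst vec_lambda_beta, subst P) simp
qed

lemma sign_matrix_mult_self: "sign_matrix P \<Longrightarrow> P ** P = mat 1"
  by (auto simp: vec_eq_iff sign_matrix_mult_component mat_def sign_matrix_def)

lemma sign_matrix_mult:
  assumes "sign_matrix P" "sign_matrix Q"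
  shows "sign_matrix (P ** Q)"
proof -
  have "(P $ i $ i * Q $ i $ i) * (P $ i $ i * Q $ i $ i) = 1" for i
  proof -
    have "(P $ i $ i * Q $ i $ i) * (P $ i $ i * Q $ i $ i)
        = (P $ i $ i * P $ i $ i) * (Q $ i $ i * Q $ i $ i)" by (simp only: ac_simps)
    also have "\<dots> = 1" using assms by (simp add: sign_matrix_def)
    finally show ?thesis .
  qed
  then show ?thesis
    using assms by (simp add: sign_matrix_def sign_matrix_mult_component[OF assms(1)])
qed

text \<open>Sign matrices are involutions. This settles the case of inverted generators in the
  induction over \<open>generate\<close>.\<close>

lemma sign_matrix_inv_O3:
  assumes "sign_matrix Q"
  shows "inv\<^bsub>O3\<^esub> Q = Q"
proof (rule group.inv_equality[OF group_O3])
  have "transpose Q = Q"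
    using assms by (auto simp: vec_eq_iff transpose_def sign_matrix_def) metis
  then show Q: "Q \<in> carrier O3" "Q \<in> carrier O3"
    using sign_matrix_mult_self[OF assms] by (auto simp: O3_def orthogonal_matrix)
  show "Q \<otimes>\<^bsub>O3\<^esub> Q = \<one>\<^bsub>O3\<^esub>"
    using sign_matrix_mult_self[OF assms] by (simp add: O3_def)
qed

lemma sign_matrix_generate:
  assumes "\<And>Q. Q \<in> S \<Longrightarrow> sign_matrix Q" "Q \<in> generate O3 S"
  shows "sign_matrix Q"
  using assms(2)
proof induction
  case one
  then show ?case by (simp add: O3_def sign_matrix_def mat_def)
next
  case (eng P Q)
  then show ?case using sign_matrix_mult[of P Q] by (simp add: O3_def)
qed (use assms(1) sign_matrix_inv_O3 in auto)

lemma sign_matrix_rotations: "sign_matrix (rotation_e3 pi)" "sign_matrix (rotation_e1 pi)"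
  by (auto simp: sign_matrix_def rotation_e3_def rotation_e1_def forall_3)

lemma sign_matrix_D2_Z2c:
  assumes "Q \<in> D2_Z2c"
  shows "sign_matrix Q"
proof (rule sign_matrix_generate)
  show "Q \<in> generate O3 (D2 \<union> {- mat 1})" using assms by (simp add: D2_Z2c_def)
  fix R assume R: "R \<in> D2 \<union> {- mat 1}"
  \<comment> \<open>\<open>D2\<close> is itself a generated group, so the closure argument is used a
    second time.\<close>
  have "sign_matrix R" if "R \<in> D2"
    using that sign_matrix_rotations unfolding D2_def by (auto elim!: sign_matrix_generate[rotated])
  moreover have "sign_matrix (- mat 1)"
    by (simp add: sign_matrix_def mat_def)
  ultimately show "sign_matrix R" using R by blast
qed

lemma rotations_in_D2_Z2c: "rotation_e3 pi \<in> D2_Z2c" "rotation_e1 pi \<in> D2_Z2c"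
  by (auto simp: D2_Z2c_def D2_def intro!: generate.incl)

lemma sign_matrix_action4:
  assumes "sign_matrix Q"
  shows "(\<Sum>j1\<in>UNIV. \<Sum>j2\<in>UNIV. \<Sum>j3\<in>UNIV. \<Sum>j4\<in>UNIV.
        Q$i1$j1 * Q$i2$j2 * Q$i3$j3 * Q$i4$j4 * T j1 j2 j3 j4)
    = Q$i1$i1 * Q$i2$i2 * Q$i3$i3 * Q$i4$i4 * T i1 i2 i3 i4"
proof -
  have Q: "Q $ i $ j = (if j = i then Q $ i $ i else 0)" for i j
    using assms by (auto simp: sign_matrix_def)
  have *: "(\<Sum>j\<in>UNIV. Q $ i $ j * g j) = Q $ i $ i * g i" for i g
    by (subst Q) (simp add: if_distrib[of "\<lambda>c. c * _"] cong: if_cong)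
  show ?thesis
    by (simp add: mult.assoc sum_distrib_left[symmetric] *)
qed

text \<open>The distinct indices \<open>j\<close>, \<open>l\<close>, \<open>m\<close> exhaust 1, 2,
  3, so their signs multiply to the determinant, which is 1 for a rotation. The component is thus
  multiplied by \<open>Q$i$i\<close>. If it is nonzero, the rotation about the third axis forces
  \<open>i = 3\<close> and the one about the first axis forces \<open>i = 1\<close>.\<close>

lemma invariant4_D2_Z2c_distinct:
  assumes C: "invariant4 D2_Z2c C" and "j \<noteq> l" "j \<noteq> m" "l \<noteq> m"
  shows "C i j l m = 0"
proof (rule ccontr)
  assume nz: "C i j l m \<noteq> 0"
  have inv: "Q$i$i * Q$j$j * Q$l$l * Q$m$m = 1" if "Q \<in> D2_Z2c" for Q
    using C sign_matrix_action4[OF sign_matrix_D2_Z2c[OF that], of i j l m C] that nz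
    by (simp add: invariant4_def)
  have e3: "rotation_e3 pi $ k $ k = (if k = 3 then 1 else - 1)"
    and e1: "rotation_e1 pi $ k $ k = (if k = 1 then 1 else - 1)" for k
    using exhaust_3[of k] by (auto simp: rotation_e3_def rotation_e1_def)
  \<comment> \<open>Together with distinctness this tells which of the three signs is 1 for each
    rotation.\<close>
  have "(j = 1 \<or> l = 1 \<or> m = 1) \<and> (j = 3 \<or> l = 3 \<or> m = 3)"
    using assms(2-) exhaust_3[of j] exhaust_3[of l] exhaust_3[of m] by metis
  then show False
    using inv[OF rotations_in_D2_Z2c(1)] inv[OF rotations_in_D2_Z2c(2)] assms(2-)
    unfolding e1 e3 by (auto split: if_splits)
qed

text \<open>These isolate the nine constants: \<open>C\<^sub>a\<^sub>a\<^sub>b\<^sub>b\<close> (including \<open>a = b\<close>) and \<open>C\<^sub>a\<^sub>b\<^sub>a\<^sub>b\<close> for \<open>a \<noteq> b\<close>.\<close>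

definition normal_stiffness :: "3 \<Rightarrow> 3 \<Rightarrow> tensor4" where
  "normal_stiffness a b i j l m = of_bool (i = j \<and> l = m \<and> {i, l} = {a, b})"

definition shear_stiffness :: "3 \<Rightarrow> 3 \<Rightarrow> tensor4" where
  "shear_stiffness a b i j l m = of_bool ({i, j} = {a, b} \<and> {l, m} = {a, b})"

text \<open>In a nonzero component the indices occur in equal pairs, so all signs square to 1. The
  zero tensors of orders 5 and 6 are invariant under any group.\<close>

lemma paired_tensor_in_class_D2v:
  assumes sym: "\<And>i j l m. C i j l m = C j i l m \<and> C i j l m = C l m i j"
    and paired: "\<And>i j l m. C i j l m \<noteq> 0 \<Longrightarrow> (i = j \<and> l = m) \<or> {i, j} = {l, m}"
  shows "(C, \<lambda>_ _ _ _ _. 0, \<lambda>_ _ _ _ _ _. 0) \<in> class_D2v"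
proof -
  have "invariant4 D2_Z2c C"
    unfolding invariant4_def
  proof (intro ballI allI)
    fix Q i j l m assume "Q \<in> D2_Z2c"
    then have Q: "sign_matrix Q" by (rule sign_matrix_D2_Z2c)
    have "Q$i$i * Q$j$j * Q$l$l * Q$m$m = 1" if "C i j l m \<noteq> 0"
    proof -
      have sq: "Q $ a $ a * Q $ a $ a = 1" for a
        using Q by (simp add: sign_matrix_def)
      have "Q$i$i * Q$j$j * Q$l$l * Q$m$m = (Q$i$i * Q$i$i) * (Q$l$l * Q$l$l)
        \<or> Q$i$i * Q$j$j * Q$l$l * Q$m$m = (Q$i$i * Q$i$i) * (Q$j$j * Q$j$j)"
        using paired[OF that] by (auto simp: doubleton_eq_iff ac_simps)
      then show ?thesis by (simp add: sq)
    qed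
    then show "(\<Sum>j1\<in>UNIV. \<Sum>j2\<in>UNIV. \<Sum>j3\<in>UNIV. \<Sum>j4\<in>UNIV.
        Q$i$j1 * Q$j$j2 * Q$l$j3 * Q$m$j4 * C j1 j2 j3 j4) = C i j l m"
      unfolding sign_matrix_action4[OF Q] by fastforce
  qed
  then show ?thesis
    using sym by (simp add: class_D2v_def index_symmetric_def invariant5_def invariant6_def)
qed

lemma normal_stiffness_in_class_D2v:
  "(normal_stiffness a b, \<lambda>_ _ _ _ _. 0, \<lambda>_ _ _ _ _ _. 0) \<in> class_D2v"
  by (rule paired_tensor_in_class_D2v) (auto simp: normal_stiffness_def doubleton_eq_iff)

lemma shear_stiffness_in_class_D2v:
  "(shear_stiffness a b, \<lambda>_ _ _ _ _. 0, \<lambda>_ _ _ _ _ _. 0) \<in> class_D2v"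
  by (rule paired_tensor_in_class_D2v) (auto simp: shear_stiffness_def insert_commute)

section \<open>The equilibrium equations\<close>

lemma smooth_on_component: "open \<Omega> \<Longrightarrow> smooth_on \<Omega> u \<Longrightarrow> smooth_on \<Omega> (\<lambda>y. u y $ l)"
  by (rule smooth_on_bounded_linear[OF _ _ bounded_linear_vec_nth])

lemma smooth_on_strain:
  assumes "open \<Omega>" "smooth_on \<Omega> u"
  shows "smooth_on \<Omega> (strain u l m)"
proof -
  have "strain u l m = (\<lambda>x. 1 / 2 * (partial_deriv m (\<lambda>y. u y $ l) x + partial_deriv l (\<lambda>y. u y $ m) x))"
    by (simp add: fun_eq_iff strain_def)
  then show ?thesis
    by (simp only:) (intro smooth_on_cmult smooth_on_add smooth_on_partial_deriv smooth_on_component assms)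
qed

lemma partial_deriv_strain:
  assumes "open \<Omega>" "smooth_on \<Omega> u" "x \<in> \<Omega>"
  shows "partial_deriv n (strain u l m) x =
    (partial_deriv n (partial_deriv m (\<lambda>y. u y $ l)) x + partial_deriv n (partial_deriv l (\<lambda>y. u y $ m)) x) / 2"
proof -
  note s = smooth_on_partial_deriv[OF smooth_on_component[OF assms(1,2)]]
  note d = smooth_on_differentiable[OF s assms(1,3)]
  have "strain u l m = (\<lambda>x. 1 / 2 * (partial_deriv m (\<lambda>y. u y $ l) x + partial_deriv l (\<lambda>y. u y $ m) x))"
    by (simp add: fun_eq_iff strain_def)
  then show ?thesis
    by (simp only: partial_deriv_cmult[OF assms(1,3) smooth_on_add[OF assms(1) s s]]
        partial_deriv_add[OF d d])
qed

text \<open>Stress and hyper-stress are both of this shape, with \<open>f\<close> the strain and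
  \<open>g\<close> its gradient.\<close>

lemma partial_deriv_contraction:
  fixes f :: "3 \<Rightarrow> 3 \<Rightarrow> real^3 \<Rightarrow> real" and g :: "3 \<Rightarrow> 3 \<Rightarrow> 3 \<Rightarrow> real^3 \<Rightarrow> real"
  assumes "open \<Omega>" "x \<in> \<Omega>" "\<And>l m. smooth_on \<Omega> (f l m)" "\<And>l m n. smooth_on \<Omega> (g l m n)"
  shows "partial_deriv j (\<lambda>x. (\<Sum>l\<in>UNIV. \<Sum>m\<in>UNIV. c l m * f l m x) +
      (\<Sum>l\<in>UNIV. \<Sum>m\<in>UNIV. \<Sum>n\<in>UNIV. d l m n * g l m n x)) x =
    (\<Sum>l\<in>UNIV. \<Sum>m\<in>UNIV. c l m * partial_deriv j (f l m) x) +
      (\<Sum>l\<in>UNIV. \<Sum>m\<in>UNIV. \<Sum>n\<in>UNIV. d l m n * partial_deriv j (g l m n) x)"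
  using assms
  by (simp add: partial_deriv_add partial_deriv_sum partial_deriv_cmult
      smooth_on_differentiable[OF _ assms(1,2)] smooth_on_sum smooth_on_cmult)

lemma partial_deriv_stress:
  assumes "open \<Omega>" "smooth_on \<Omega> u" "x \<in> \<Omega>"
  shows "partial_deriv j (stress (C, M, A) u i k) x =
    (\<Sum>l\<in>UNIV. \<Sum>m\<in>UNIV. C i k l m * partial_deriv j (strain u l m) x) +
    (\<Sum>l\<in>UNIV. \<Sum>m\<in>UNIV. \<Sum>n\<in>UNIV.
       M i k l m n * partial_deriv j (partial_deriv n (strain u l m)) x)"
  unfolding stress_def prod.case
  by (intro partial_deriv_contraction[OF assms(1,3)] smooth_on_partial_deriv smooth_on_strain assms)

lemma partial_deriv_hyperstress:
  assumes "open \<Omega>" "smooth_on \<Omega> u" "x \<in> \<Omega>"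
  shows "partial_deriv p (hyperstress (C, M, A) u i j k) x =
    (\<Sum>l\<in>UNIV. \<Sum>m\<in>UNIV. M l m i j k * partial_deriv p (strain u l m) x) +
    (\<Sum>l\<in>UNIV. \<Sum>m\<in>UNIV. \<Sum>n\<in>UNIV.
       A i j k l m n * partial_deriv p (partial_deriv n (strain u l m)) x)"
  unfolding hyperstress_def prod.case
  by (intro partial_deriv_contraction[OF assms(1,3)] smooth_on_partial_deriv smooth_on_strain assms)

lemma equilibrium_classical_imp:
  assumes "open \<Omega>" "smooth_on \<Omega> u" "x \<in> \<Omega>"
    and "equilibrium \<Omega> (C, \<lambda>_ _ _ _ _. 0, \<lambda>_ _ _ _ _ _. 0) u"
  shows "(\<Sum>j\<in>UNIV. \<Sum>l\<in>UNIV. \<Sum>m\<in>UNIV. C i j l m * partial_deriv j (strain u l m) x) = 0"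
proof -
  have "hyperstress (C, \<lambda>_ _ _ _ _. 0, \<lambda>_ _ _ _ _ _. 0) u i j k = (\<lambda>x. 0)" for j k
    by (simp add: hyperstress_def)
  moreover have "partial_deriv j (\<lambda>x. 0 :: real) = (\<lambda>x. 0)" for j
    by (simp add: fun_eq_iff partial_deriv_const)
  ultimately show ?thesis
    using assms by (simp add: equilibrium_def partial_deriv_stress)
qed

text \<open>If the strain gradient is constant, the hyper-stress is affine, so that neither \<open>M\<close> nor \<open>A\<close>
  contributes to the equilibrium equations.\<close>

lemma equilibrium_constant_strain_gradient:
  assumes "open \<Omega>" "smooth_on \<Omega> u"
    and E: "\<And>x l m n. x \<in> \<Omega> \<Longrightarrow> partial_deriv n (strain u l m) x = E l m n"
    and "\<And>i. (\<Sum>j\<in>UNIV. \<Sum>l\<in>UNIV. \<Sum>m\<in>UNIV. C i j l m * E l m j) = 0"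
  shows "equilibrium \<Omega> (C, M, A) u"
proof -
  have E': "partial_deriv p (partial_deriv n (strain u l m)) x = 0" if "x \<in> \<Omega>" for p n l m x
    using assms(1) that E by (rule partial_deriv_eq_0)
  have "partial_deriv k (partial_deriv j (hyperstress (C, M, A) u i j k)) x = 0"
    if x: "x \<in> \<Omega>" for i j k x
    \<comment> \<open>The constant is what remains of the first derivative of the hyper-stress once
      the \<open>A\<close> term vanishes by \<open>E'\<close>.\<close>
    by (rule partial_deriv_eq_0[OF assms(1) x, where c = "\<Sum>l\<in>UNIV. \<Sum>m\<in>UNIV. M l m i j k * E l m j"])
       (simp add: partial_deriv_hyperstress[OF assms(1,2)] E E')
  then show ?thesis
    using assms(4) by (simp add: equilibrium_def partial_deriv_stress[OF assms(1,2)] E E')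
qed

section \<open>Necessity: second derivatives of a universal field\<close>

lemma universal_imp_second_derivs:
  fixes u :: "real^3 \<Rightarrow> real^3"
  assumes "open \<Omega>" "smooth_on \<Omega> u" "universal class_D2v \<Omega> u" "x \<in> \<Omega>"
    and nd: "\<not> (a \<noteq> j \<and> a \<noteq> k \<and> j \<noteq> k)"
  shows "partial_deriv k (partial_deriv j (\<lambda>y. u y $ a)) x = 0"
proof -
  have comm: "partial_deriv j (partial_deriv i (\<lambda>y. u y $ l)) x
      = partial_deriv i (partial_deriv j (\<lambda>y. u y $ l)) x" for i j l
    by (rule partial_deriv_commute[OF assms(1) smooth_on_component[OF assms(1,2)] assms(4)])
  note strain = partial_deriv_strain[OF assms(1,2,4)]
  have eq: "(\<Sum>j\<in>UNIV. \<Sum>l\<in>UNIV. \<Sum>m\<in>UNIV. C i j l m * partial_deriv j (strain u l m) x) = 0"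
    if "(C, \<lambda>_ _ _ _ _. 0, \<lambda>_ _ _ _ _ _. 0) \<in> class_D2v" for C i
    using that assms(3) by (intro equilibrium_classical_imp[OF assms(1,2,4)]) (auto simp: universal_def)
  \<comment> \<open>In the equation with free index \<open>a\<close>, the tensor
    \<open>normal_stiffness a b\<close> leaves the single term \<open>j = a\<close>,
    \<open>l = m = b\<close>.\<close>
  have normal: "partial_deriv a (strain u b b) x = 0" for a b
    using eq[OF normal_stiffness_in_class_D2v, of a b a] exhaust_3[of a] exhaust_3[of b]
    by (auto simp: normal_stiffness_def sum_3 doubleton_eq_iff)
  then have longitudinal: "partial_deriv a (partial_deriv b (\<lambda>y. u y $ b)) x = 0" for a b
    by (simp add: strain)
  \<comment> \<open>In the equation with free index \<open>a\<close>, the tensor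
    \<open>shear_stiffness a b\<close> forces \<open>j = b\<close> and leaves the two orders of
    \<open>l\<close>, \<open>m\<close>.\<close>
  have shear: "partial_deriv b (strain u a b) x + partial_deriv b (strain u b a) x = 0"
    if "a \<noteq> b" for a b
    using eq[OF shear_stiffness_in_class_D2v, of a b a] that exhaust_3[of a] exhaust_3[of b]
    by (auto simp: shear_stiffness_def sum_3 doubleton_eq_iff)
  \<comment> \<open>The shear equation is the sum of the derivative sought and a mixed derivative of
    component \<open>b\<close>; the latter is longitudinal after commuting.\<close>
  have transversal: "partial_deriv b (partial_deriv b (\<lambda>y. u y $ a)) x = 0" for a b
    using shear[of a b] longitudinal[of b a] longitudinal[of a b] comm[of b a b]
    by (cases "a = b") (simp_all add: strain)
  from nd consider "j = k" | "a = j" | "a = k" by blast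
  then show ?thesis
  proof cases
    case 1
    then show ?thesis by (simp add: transversal)
  next
    case 2
    then show ?thesis by (simp add: longitudinal)
  next
    case 3
    then show ?thesis using comm[of k j a] by (simp add: longitudinal)
  qed
qed

text \<open>If \<open>a\<close>, \<open>j\<close>, \<open>k\<close> are distinct, the index of a third differentiation is one of them, so that
  reordering exposes a second derivative that vanishes by assumption.\<close>

lemma second_derivs_constant:
  fixes f :: "real^3 \<Rightarrow> real" and a :: 3
  assumes "open \<Omega>" "convex \<Omega>" "smooth_on \<Omega> f"
    and zero: "\<And>x j k. x \<in> \<Omega> \<Longrightarrow> \<not> (a \<noteq> j \<and> a \<noteq> k \<and> j \<noteq> k)
      \<Longrightarrow> partial_deriv k (partial_deriv j f) x = 0"
  shows "\<exists>c. \<forall>x\<in>\<Omega>. partial_deriv k (partial_deriv j f) x = c"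
proof (cases "a \<noteq> j \<and> a \<noteq> k \<and> j \<noteq> k")
  case True
  note comm = partial_deriv_commute[OF assms(1)]
  have third0: "partial_deriv n (partial_deriv k (partial_deriv j f)) x = 0"
    if "\<not> (a \<noteq> j \<and> a \<noteq> k \<and> j \<noteq> k)" "x \<in> \<Omega>" for n k j x
    using assms(1) that(2) zero[OF _ that(1)] by (rule partial_deriv_eq_0)
  have third1: "partial_deriv n (partial_deriv k (partial_deriv j f)) x
      = partial_deriv k (partial_deriv n (partial_deriv j f)) x" if "x \<in> \<Omega>" for n k j x
    using that by (intro comm smooth_on_partial_deriv assms)
  have third2: "partial_deriv n (partial_deriv k (partial_deriv j f)) x
      = partial_deriv n (partial_deriv j (partial_deriv k f)) x" if "x \<in> \<Omega>" for n k j x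
    by (rule partial_deriv_cong[OF assms(1) that comm[OF assms(3)]])
  have third: "partial_deriv n (partial_deriv k (partial_deriv j f)) x = 0" if x: "x \<in> \<Omega>" for n x
  proof -
    from True consider "n = a" | "n = j" | "n = k"
      using exhaust_3[of a] exhaust_3[of j] exhaust_3[of k] exhaust_3[of n] by auto
    then show ?thesis
    proof cases
      case 1
      then show ?thesis using third1[OF x, of n k j] third0[of j n x k] x by simp
    next
      case 2
      then show ?thesis using third1[OF x, of n k j] third0[of j n x k] x by simp
    next
      case 3
      then show ?thesis
        using third2[OF x, of n k j] third1[OF x, of n j k] third0[of k n x j] x by simp
    qed
  qed
  \<comment> \<open>Comparison with the zero function turns vanishing third derivatives into
    constancy.\<close>
  have "\<exists>c. \<forall>x\<in>\<Omega>. partial_deriv k (partial_deriv j f) x - 0 = c"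
    using smooth_on_differentiable[OF smooth_on_partial_deriv[OF smooth_on_partial_deriv[OF assms(3)]] assms(1)]
    by (intro partial_derivs_eq_imp_diff_const[OF assms(1,2)]) (auto simp: third partial_deriv_const)
  then show ?thesis by simp
qed (use zero in blast)

text \<open>The second derivatives are constant, so their values at any point of the nonempty domain
  serve as the Hessian \<open>D\<close>.\<close>

lemma second_derivs_imp_quadratic:
  fixes f :: "real^3 \<Rightarrow> real" and a :: 3
  assumes "open \<Omega>" "convex \<Omega>" "\<Omega> \<noteq> {}" "smooth_on \<Omega> f"
    and zero: "\<And>x j k. x \<in> \<Omega> \<Longrightarrow> \<not> (a \<noteq> j \<and> a \<noteq> k \<and> j \<noteq> k)
      \<Longrightarrow> partial_deriv k (partial_deriv j f) x = 0"
  shows "\<exists>b w D. (\<forall>j k. D j k = D k j) \<and> (\<forall>j k. \<not> (a \<noteq> j \<and> a \<noteq> k \<and> j \<noteq> k) \<longrightarrow> D j k = 0)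
    \<and> (\<forall>x\<in>\<Omega>. f x = quadratic b w D x)"
proof -
  obtain x0 where x0: "x0 \<in> \<Omega>" using assms(3) by blast
  define D where "D j k = partial_deriv k (partial_deriv j f) x0" for j k
  have sym: "D j k = D k j" for j k
    unfolding D_def by (rule partial_deriv_commute[OF assms(1,4) x0])
  have zeroD: "D j k = 0" if "\<not> (a \<noteq> j \<and> a \<noteq> k \<and> j \<noteq> k)" for j k
    unfolding D_def by (rule zero[OF x0 that])
  have "\<exists>b w. \<forall>x\<in>\<Omega>. f x = quadratic b w D x"
  proof (rule constant_second_derivs_imp_quadratic[OF assms(1,2,4) sym])
    show "partial_deriv k (partial_deriv j f) x = D j k" if "x \<in> \<Omega>" for x j k
      using second_derivs_constant[OF assms(1,2,4) zero, where j = j and k = k] that x0 unfolding D_def by metis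
  qed
  then obtain b w where "\<forall>x\<in>\<Omega>. f x = quadratic b w D x" by blast
  then show ?thesis
    by (intro exI[of _ b] exI[of _ w] exI[of _ D] conjI allI impI sym zeroD)
qed

theorem proposition3p6:
  fixes \<Omega> :: "(real^3) set" and u :: "real^3 \<Rightarrow> real^3"
  assumes "\<Omega> \<noteq> {}" and "open \<Omega>" and "convex \<Omega>" and "smooth_on \<Omega> u"
  shows "universal class_D2v \<Omega> u \<longleftrightarrow>
    (\<exists>v \<alpha>1 \<alpha>2 \<alpha>3. homogeneous_on \<Omega> v \<and>
       (\<forall>x\<in>\<Omega>. u x = v x + vector [\<alpha>1 * x$2 * x$3, \<alpha>2 * x$1 * x$3, \<alpha>3 * x$1 * x$2]))"
proof
  assume univ: "universal class_D2v \<Omega> u"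
  have "\<exists>b w D. (\<forall>j k. D j k = D k j) \<and> (\<forall>j k. \<not> (a \<noteq> j \<and> a \<noteq> k \<and> j \<noteq> k) \<longrightarrow> D j k = 0)
    \<and> (\<forall>x\<in>\<Omega>. u x $ a = quadratic b w D x)" for a
    using universal_imp_second_derivs[OF assms(2,4) univ]
    by (intro second_derivs_imp_quadratic assms smooth_on_component)
  then obtain b w D where sym: "\<And>a j k. D a j k = D a k j"
    and zero: "\<And>a j k. \<not> (a \<noteq> j \<and> a \<noteq> k \<and> j \<noteq> k) \<Longrightarrow> D a j k = 0"
    and u: "\<And>a x. x \<in> \<Omega> \<Longrightarrow> u x $ a = quadratic (b a) (w a) (D a) x"
    by metis
  \<comment> \<open>The terms of degree at most one in all three components form the homogeneous
    part.\<close>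
  define v :: "real^3 \<Rightarrow> real^3" where "v x = (\<chi> i j. w i j) *v x + (\<chi> i. b i)" for x
  have "homogeneous_on \<Omega> v"
    unfolding homogeneous_on_def v_def by blast
  \<comment> \<open>In each component only two entries of \<open>D a\<close> can be nonzero. They
    are equal by symmetry, which cancels the factor 1/2 in \<open>quadratic\<close>.\<close>
  moreover have "u x = v x + vector [D 1 2 3 * x$2 * x$3, D 2 1 3 * x$1 * x$3, D 3 1 2 * x$1 * x$2]"
    if "x \<in> \<Omega>" for x
    by (simp add: u[OF that] vec_eq_iff forall_3 v_def quadratic_def matrix_vector_mult_def sum_3 zero
        sym[of 1 3 2] sym[of 2 3 1] sym[of 3 2 1] field_simps)
  ultimately show "\<exists>v \<alpha>1 \<alpha>2 \<alpha>3. homogeneous_on \<Omega> v \<and>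
       (\<forall>x\<in>\<Omega>. u x = v x + vector [\<alpha>1 * x$2 * x$3, \<alpha>2 * x$1 * x$3, \<alpha>3 * x$1 * x$2])"
    by blast
next
  assume "\<exists>v \<alpha>1 \<alpha>2 \<alpha>3. homogeneous_on \<Omega> v \<and>
       (\<forall>x\<in>\<Omega>. u x = v x + vector [\<alpha>1 * x$2 * x$3, \<alpha>2 * x$1 * x$3, \<alpha>3 * x$1 * x$2])"
  then obtain H :: "real^3^3" and b :: "real^3" and \<alpha>1 \<alpha>2 \<alpha>3 where
    u: "\<And>x. x \<in> \<Omega> \<Longrightarrow>
      u x = H *v x + b + vector [\<alpha>1 * x$2 * x$3, \<alpha>2 * x$1 * x$3, \<alpha>3 * x$1 * x$2]"
    unfolding homogeneous_on_def by metis
  define \<alpha> :: "real^3" where "\<alpha> = vector [\<alpha>1, \<alpha>2, \<alpha>3]"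
  \<comment> \<open>The constant second derivatives of the given field: component \<open>l\<close>
    is bilinear in the two other coordinates.\<close>
  define D where "D l j k = (if l \<noteq> j \<and> l \<noteq> k \<and> j \<noteq> k then \<alpha> $ l else 0)" for l j k :: 3
  have sym: "D l j k = D l k j" for l j k by (auto simp: D_def)
  have uq: "u x $ l = quadratic (b $ l) (($) (H $ l)) (D l) x" if "x \<in> \<Omega>" for x l
    using exhaust_3[of l]
    by (auto simp: u[OF that] quadratic_def matrix_vector_mult_def sum_3 D_def \<alpha>_def field_simps)
  have d1: "partial_deriv m (\<lambda>y. u y $ l) x = quadratic (H $ l $ m) (D l m) (\<lambda>_ _. 0) x"
    if "x \<in> \<Omega>" for x l m
    using partial_deriv_cong[OF assms(2) that uq] by (simp add: partial_deriv_quadratic sym)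
  have "partial_deriv n (partial_deriv m (\<lambda>y. u y $ l)) x = D l m n" if "x \<in> \<Omega>" for x l m n
    using partial_deriv_cong[OF assms(2) that d1] by (simp add: partial_deriv_affine)
  then have E: "partial_deriv n (strain u l m) x = (D l m n + D m l n) / 2" if "x \<in> \<Omega>" for x l m n
    using that by (simp add: partial_deriv_strain[OF assms(2,4)])
  show "universal class_D2v \<Omega> u"
    unfolding universal_def
  proof
    fix \<mu> assume "\<mu> \<in> class_D2v"
    then obtain C M A where \<mu>: "\<mu> = (C, M, A)" and C: "invariant4 D2_Z2c C"
      by (auto simp: class_D2v_def)
    \<comment> \<open>If \<open>l\<close>, \<open>m\<close>, \<open>j\<close> are distinct the
      factor from \<open>C\<close> vanishes; otherwise both \<open>D\<close> terms do.\<close>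
    have zero: "C i j l m * ((D l m j + D m l j) / 2) = 0" for i j l m
      using invariant4_D2_Z2c_distinct[OF C, of j l m i] by (auto simp: D_def)
    then show "equilibrium \<Omega> \<mu> u"
      unfolding \<mu>
      by (intro equilibrium_constant_strain_gradient[OF assms(2,4) E]) (simp_all only: zero sum.neutral_const)
  qed
qed

end
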